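(* Let $K$ be a field, let $R = K[x_1,\ldots,x_n]$ be standard graded, and let $M$ be a finitely generated graded $R$-module with a pure resolution of type $\mathbf{d} = (d_0,\ldots,d_t)$, where $d_0 < \cdots < d_t$ are integers. Let $\beta = \beta(M)$, and suppose that the truncation $\beta'$ of $\beta$ is the Betti table of a finitely generated graded $R$-module with Boij-Söderberg decomposition given by $$\beta' = \sum_{j=1}^{t} \alpha_j \cdot \pi(d_1,\ldots,d_j).$$ Then, setting $\alpha_{t+1} = 0$, $$\beta = (\beta_{0,d_0} - \alpha_1)\cdot \pi(d_0) + \sum_{j=1}^{t}\Big((d_j - d_0)\alpha_j - \alpha_{j+1}\Big)\cdot \pi(d_0,\ldots,d_j).$$
   Context: For a finitely generated graded $R$-module $M$ with minimal graded free resolution $0\to F_n\to\cdots\to F_0\to M\to 0$, $F_i = \bigoplus_{j\in\mathbb{Z}} R(-j)^{\beta_{i,j}(M)}$, the Betti table of $M$ is $\beta(M) = (\beta_{i,j}(M))_{i,j}$ (here $i$ is the homological degree and $j$ the internal degree). For an increasing sequence of integers $\mathbf{d} = (d_0,\ldots,d_s)$ with $0\le s\le n$, the pure diagram $\pi(\mathbf{d})=\pi(d_0,\ldots,d_s)$ is the table with entries $$\pi(\mathbf{d})_{i,j} = (-1)^i\prod_{k=0,\,k\ne i}^{s}\frac{1}{d_k-d_i}\ \text{ if } 0\le i\le s \text{ and } j=d_i,\qquad \pi(\mathbf{d})_{i,j}=0 \text{ otherwise.}$$ In $\pi(d_1,\ldots,d_j)$ the entry $d_1$ sits in homological position $0$,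 $d_2$ in position $1$, and so on. Pure diagrams are partially ordered by $\pi(d_0,\ldots,d_s)\le\pi(d'_0,\ldots,d'_t)$ if $s\ge t$ and $d_i\le d'_i$ for $0\le i\le t$. The Boij-Söderberg decomposition of the Betti table of a finitely generated graded $R$-module is its unique expression as a linear combination, with positive integer coefficients, of pure diagrams forming a chain in this order. In particular the $\alpha_1,\ldots,\alpha_t$ in the claim are positive integers. $M$ has a pure resolution of type $(d_0,\ldots,d_t)$ if $\beta_{i,j}(M)\neq 0$ precisely when $0\le i\le t$ and $j=d_i$. The truncation $\beta'$ of $\beta=\beta(M)$ is the table with $\beta'_{i-1,j} = \beta_{i,j}$ for all $i\ge 1$ and all $j$. *)

theory Defs
  imports Complex_Main "HOL-Library.Poly_Mapping" "HOL-Algebra.Module" "HOL-Algebra.AbelCoset"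
begin

section \<open>Graded modules over a standard graded polynomial ring\<close>

text \<open>
  A polynomial is a finitely supported family of coefficients indexed by monomials, a monomial
  being the finitely supported family of its exponents.  The variables
  \<open>x\<^sub>1, \<dots>, x\<^sub>n\<close> are indexed by \<open>0, \<dots>, n - 1\<close>; the number \<open>n\<close> cuts out the carrier.
\<close>

type_synonym 'k mpoly = "(nat \<Rightarrow>\<^sub>0 nat) \<Rightarrow>\<^sub>0 'k"

definition poly_ring :: "nat \<Rightarrow> ('k::field) mpoly ring" where
  "poly_ring n =
    \<lparr>carrier = {p. \<forall>m \<in> Poly_Mapping.keys p. Poly_Mapping.keys m \<subseteq> {..<n}},
     mult = (*), one = 1, zero = 0, add = (+)\<rparr>"

definition monom_deg :: "(nat \<Rightarrow>\<^sub>0 nat) \<Rightarrow> nat" where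
  "monom_deg m = (\<Sum>i \<in> Poly_Mapping.keys m. Poly_Mapping.lookup m i)"

definition poly_component :: "nat \<Rightarrow> int \<Rightarrow> ('k::field) mpoly set" where
  "poly_component n e =
    {p \<in> carrier (poly_ring n). \<forall>m \<in> Poly_Mapping.keys p. int (monom_deg m) = e}"

text \<open>The ideal generated by the variables: the polynomials without constant term.\<close>

definition irrelevant_ideal :: "nat \<Rightarrow> ('k::field) mpoly set" where
  "irrelevant_ideal n = {p \<in> carrier (poly_ring n). Poly_Mapping.lookup p 0 = 0}"

record ('r, 'm) gmodule = "('r, 'm) module" +
  component :: "int \<Rightarrow> 'm set"

locale graded_module = module "poly_ring n" M
  for n :: nat and M :: "(('k::field) mpoly, 'm, 'z) gmodule_scheme" +
  assumes component_subgroup: "subgroup (component M j) (add_monoid M)"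
    and component_smult:
      "p \<in> poly_component n e \<Longrightarrow> x \<in> component M j \<Longrightarrow> p \<odot>\<^bsub>M\<^esub> x \<in> component M (e + j)"
    and component_direct_sum:
      "x \<in> carrier M \<Longrightarrow>
        \<exists>!c. (\<forall>j. c j \<in> component M j) \<and> finite {j. c j \<noteq> \<zero>\<^bsub>M\<^esub>} \<and>
             x = (\<Oplus>\<^bsub>M\<^esub>j \<in> {j. c j \<noteq> \<zero>\<^bsub>M\<^esub>}. c j)"

definition finitely_generated ::
  "nat \<Rightarrow> (('k::field) mpoly, 'm, 'z) gmodule_scheme \<Rightarrow> bool" where
  "finitely_generated n M \<longleftrightarrow>
    (\<exists>S. finite S \<and> S \<subseteq> carrier M \<and>
      (\<forall>x \<in> carrier M. \<exists>a \<in> S \<rightarrow> carrier (poly_ring n). x = (\<Oplus>\<^bsub>M\<^esub>s \<in> S. a s \<odot>\<^bsub>M\<^esub> s)))"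

definition graded_hom ::
  "nat \<Rightarrow> (('k::field) mpoly, 'm, 'z) gmodule_scheme \<Rightarrow> ('k mpoly, 'l, 'w) gmodule_scheme
    \<Rightarrow> ('m \<Rightarrow> 'l) set" where
  "graded_hom n M N =
    {f \<in> hom (add_monoid M) (add_monoid N).
      (\<forall>p \<in> carrier (poly_ring n). \<forall>x \<in> carrier M. f (p \<odot>\<^bsub>M\<^esub> x) = p \<odot>\<^bsub>N\<^esub> f x) \<and>
      (\<forall>j. f ` component M j \<subseteq> component N j)}"


section \<open>Minimal graded free resolutions and Betti tables\<close>

text \<open>
  The graded free module \<open>R(-a\<^sub>0) \<oplus> \<dots> \<oplus> R(-a\<^sub>r)\<close> for the list \<open>as = [a\<^sub>0, \<dots>, a\<^sub>r]\<close>.  Its elements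
  are the coordinate vectors, continued by zero; the \<open>k\<close>-th basis vector is homogeneous of
  degree \<open>a\<^sub>k\<close>.  The fields \<open>mult\<close> and \<open>one\<close> of the record play no role for modules.
\<close>

definition free_gmodule :: "nat \<Rightarrow> int list \<Rightarrow> (('k::field) mpoly, nat \<Rightarrow> 'k mpoly) gmodule" where
  "free_gmodule n as =
    \<lparr>carrier = {v. (\<forall>k < length as. v k \<in> carrier (poly_ring n)) \<and> (\<forall>k \<ge> length as. v k = 0)},
     mult = undefined, one = undefined,
     zero = (\<lambda>k. 0), add = (\<lambda>v w k. v k + w k), smult = (\<lambda>p v k. p * v k),
     component = (\<lambda>j. {v. (\<forall>k < length as. v k \<in> poly_component n (j - as ! k)) \<and>
                          (\<forall>k \<ge> length as. v k = 0)})\<rparr>"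

text \<open>
  The complex \<open>0 \<rightarrow> F\<^sub>n \<rightarrow> \<dots> \<rightarrow> F\<^sub>0 \<rightarrow> M \<rightarrow> 0\<close> where \<open>F\<^sub>i\<close> has basis degrees \<open>as i\<close>, the
  differential \<open>F\<^sub>i\<^sub>+\<^sub>1 \<rightarrow> F\<^sub>i\<close> is \<open>\<delta> i\<close> and \<open>\<epsilon>\<close> is the augmentation.  Since \<open>F\<^sub>i = 0\<close> for \<open>i > n\<close>,
  exactness at \<open>F\<^sub>n\<close> says that \<open>F\<^sub>n \<rightarrow> F\<^sub>n\<^sub>-\<^sub>1\<close> is injective.  Minimality means that the differentials
  have image in \<open>\<mm> F\<^sub>i\<close>, that is, in the vectors with all coordinates in the irrelevant ideal.
\<close>

definition minimal_graded_free_resolution ::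
  "nat \<Rightarrow> (('k::field) mpoly, 'm, 'z) gmodule_scheme \<Rightarrow> (nat \<Rightarrow> int list) \<Rightarrow>
    (nat \<Rightarrow> (nat \<Rightarrow> 'k mpoly) \<Rightarrow> (nat \<Rightarrow> 'k mpoly)) \<Rightarrow> ((nat \<Rightarrow> 'k mpoly) \<Rightarrow> 'm) \<Rightarrow> bool" where
  "minimal_graded_free_resolution n M as \<delta> \<epsilon> \<longleftrightarrow>
    (let F = (\<lambda>i. free_gmodule n (as i)) in
      (\<forall>i > n. as i = []) \<and>
      \<epsilon> \<in> graded_hom n (F 0) M \<and>
      (\<forall>i. \<delta> i \<in> graded_hom n (F (Suc i)) (F i)) \<and>
      \<epsilon> ` carrier (F 0) = carrier M \<and>
      a_kernel (F 0) M \<epsilon> = \<delta> 0 ` carrier (F 1) \<and>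
      (\<forall>i. a_kernel (F (Suc i)) (F i) (\<delta> i) = \<delta> (Suc i) ` carrier (F (Suc (Suc i)))) \<and>
      (\<forall>i. \<forall>v \<in> carrier (F (Suc i)). \<forall>k < length (as i). \<delta> i v k \<in> irrelevant_ideal n))"

text \<open>
  \<open>betti n M i j\<close> is the multiplicity of \<open>R(-j)\<close> in \<open>F\<^sub>i\<close>.  A minimal graded free resolution of a
  finitely generated graded module exists by Hilbert's syzygy theorem and is unique up to
  isomorphism, so the description determines the table.
\<close>

definition betti :: "nat \<Rightarrow> (('k::field) mpoly, 'm, 'z) gmodule_scheme \<Rightarrow> nat \<Rightarrow> int \<Rightarrow> nat" where
  "betti n M =
    (THE \<beta>. \<exists>as \<delta> \<epsilon>. minimal_graded_free_resolution n M as \<delta> \<epsilon> \<and>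
              (\<forall>i j. \<beta> i j = count_list (as i) j))"

definition has_pure_resolution ::
  "nat \<Rightarrow> (('k::field) mpoly, 'm, 'z) gmodule_scheme \<Rightarrow> int list \<Rightarrow> bool" where
  "has_pure_resolution n M ds \<longleftrightarrow>
    (\<forall>i j. betti n M i j \<noteq> 0 \<longleftrightarrow> i < length ds \<and> j = ds ! i)"

definition truncation :: "(nat \<Rightarrow> int \<Rightarrow> 'a) \<Rightarrow> nat \<Rightarrow> int \<Rightarrow> 'a" where
  "truncation \<beta> i j = \<beta> (Suc i) j"


section \<open>Pure diagrams and Boij-Soederberg decompositions\<close>

text \<open>A degree sequence \<open>(d\<^sub>0, \<dots>, d\<^sub>s)\<close> is the list of its \<open>s + 1\<close> entries.\<close>

definition pure_diagram :: "int list \<Rightarrow> nat \<Rightarrow> int \<Rightarrow> rat" where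
  "pure_diagram ds i j =
    (if i < length ds \<and> j = ds ! i
     then (-1) ^ i * (\<Prod>k \<in> {..<length ds} - {i}. 1 / of_int (ds ! k - ds ! i))
     else 0)"

text \<open>
  The order on pure diagrams, expressed on degree sequences; an increasing sequence can be
  read off from its pure diagram.
\<close>

definition pure_le :: "int list \<Rightarrow> int list \<Rightarrow> bool" where
  "pure_le ds es \<longleftrightarrow> length es \<le> length ds \<and> (\<forall>i < length es. ds ! i \<le> es ! i)"

text \<open>
  The table \<open>\<beta>\<close> is the sum of \<open>\<alpha> k\<close> times the pure diagram of \<open>D k\<close> over the finite index set
  \<open>I\<close>.  Each degree sequence is indexed only once.
\<close>

definition boij_soederberg_decomposition ::
  "nat \<Rightarrow> (nat \<Rightarrow> int \<Rightarrow> nat) \<Rightarrow> 'i set \<Rightarrow> ('i \<Rightarrow> int) \<Rightarrow> ('i \<Rightarrow> int list) \<Rightarrow> bool" where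
  "boij_soederberg_decomposition n \<beta> I \<alpha> D \<longleftrightarrow>
    finite I \<and> inj_on D I \<and>
    (\<forall>k \<in> I. 1 \<le> length (D k) \<and> length (D k) \<le> n + 1 \<and> sorted_wrt (<) (D k)) \<and>
    (\<forall>k \<in> I. \<alpha> k > 0) \<and>
    (\<forall>k \<in> I. \<forall>l \<in> I. pure_le (D k) (D l) \<or> pure_le (D l) (D k)) \<and>
    (\<forall>i j. of_nat (\<beta> i j) = (\<Sum>k \<in> I. of_int (\<alpha> k) * pure_diagram (D k) i j))"

end

theory Submission
  imports Defs
begin

text \<open>
  Prepending \<open>d\<^sub>0\<close> divides the entries of a pure diagram in internal degree \<open>j\<close> by
  \<open>j - d\<^sub>0\<close> and shifts them one homological position, while appending \<open>d\<^sub>k\<close> divides them by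
  \<open>d\<^sub>k - j\<close>.  The first fact turns the claim in positive homological degree into an identity
  between diagrams \<open>\<pi>(d\<^sub>1, \<dots>, d\<^sub>k)\<close>.  By the second fact the sums telescope, both in this case
  and in homological degree \<open>0\<close>.
\<close>

lemma pure_diagram_eq_0: "\<not> (i < length ds \<and> j = ds ! i) \<Longrightarrow> pure_diagram ds i j = 0"
  by (auto simp: pure_diagram_def)

text \<open>The new entry contributes the factor \<open>1 / (x - j)\<close>, and the shift of
  position changes the sign to that of \<open>1 / (j - x)\<close>. If \<open>j = x\<close>, both
  sides are \<open>0\<close>, since division by zero gives \<open>0\<close>.\<close>

lemma pure_diagram_Cons:
  "pure_diagram (x # ds) (Suc i) j = pure_diagram ds i j / of_int (j - x)"
proof (cases "i < length ds \<and> j = ds ! i")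
  case True
  have idx: "{..<length (x # ds)} - {Suc i} = insert 0 (Suc ` ({..<length ds} - {i}))"
    by (auto simp: lessThan_Suc_eq_insert_0)
  have "(\<Prod>k\<in>{..<length (x # ds)} - {Suc i}. 1 / of_int ((x # ds) ! k - (x # ds) ! Suc i) :: rat)
      = 1 / of_int (x - j) * (\<Prod>k\<in>{..<length ds} - {i}. 1 / of_int (ds ! k - ds ! i))"
    unfolding idx using True by (subst prod.insert) (auto simp: prod.reindex)
  also have "1 / of_int (x - j) = - (1 / of_int (j - x) :: rat)"
    by (metis minus_diff_eq minus_divide_right of_int_minus)
  finally show ?thesis
    using True by (simp add: pure_diagram_def)
next
  case False
  then show ?thesis
    by (simp add: pure_diagram_eq_0)
qed

lemma pure_diagram_snoc:
  assumes "i < length ds"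
  shows "pure_diagram (ds @ [y]) i j = pure_diagram ds i j / of_int (y - j)"
proof (cases "j = ds ! i")
  case True
  have idx: "{..<length (ds @ [y])} - {i} = insert (length ds) ({..<length ds} - {i})"
    using assms by auto
  have "(\<Prod>k\<in>{..<length (ds @ [y])} - {i}. 1 / of_int ((ds @ [y]) ! k - (ds @ [y]) ! i) :: rat)
      = 1 / of_int (y - j) * (\<Prod>k\<in>{..<length ds} - {i}. 1 / of_int (ds ! k - ds ! i))"
    unfolding idx using assms True by (subst prod.insert) (auto simp: nth_append)
  then show ?thesis
    using assms True by (simp add: pure_diagram_def nth_append)
next
  case False
  then show ?thesis
    using assms by (simp add: pure_diagram_eq_0 nth_append)
qed

text \<open>Clearing the denominator covers the appended position as well: there
  \<open>j = y\<close>, so the factor \<open>y - j\<close> kills the new entry.\<close>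

lemma pure_diagram_snoc_mult:
  assumes "y \<notin> set ds"
  shows "of_int (y - j) * pure_diagram (ds @ [y]) i j = pure_diagram ds i j"
proof (cases "i < length ds \<and> j = ds ! i")
  case True
  then have "of_int (y - j) \<noteq> (0 :: rat)"
    using assms nth_mem by fastforce
  then show ?thesis
    using True by (simp add: pure_diagram_snoc)
next
  case False
  then show ?thesis
    by (auto simp: pure_diagram_def nth_append)
qed

text \<open>Since \<open>d k - j\<close> removes the last entry \<open>d k\<close>, each summand is
  \<open>\<alpha> k\<close> times the diagram ending in \<open>d (k - 1)\<close> minus
  \<open>\<alpha> (Suc k)\<close> times the one ending in \<open>d k\<close>. Homological degree
  \<open>0\<close> uses \<open>m = 0\<close>, positive degrees use \<open>m = 1\<close>.\<close>

lemma sum_pure_diagram_telescope: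
  fixes d \<alpha> :: "nat \<Rightarrow> int"
  assumes "inj_on d {..t}" and "m \<le> 1"
  shows "(\<Sum>k = 1..t. of_int ((d k - j) * \<alpha> k - \<alpha> (Suc k)) * pure_diagram (map d [m..<Suc k]) i j)
    = of_int (\<alpha> 1) * pure_diagram (map d [m..<1]) i j
      - of_int (\<alpha> (Suc t)) * pure_diagram (map d [m..<Suc t]) i j"
  using assms(1)
proof (induction t)
  case 0
  then show ?case by simp
next
  case (Suc t)
  have "d (Suc t) \<notin> set (map d [m..<Suc t])"
    by (auto simp: inj_on_eq_iff[OF Suc.prems] simp del: upt_Suc)
  from pure_diagram_snoc_mult[OF this, of j i]
  have *: "of_int (d (Suc t) - j) * pure_diagram (map d [m..<Suc (Suc t)]) i j
      = pure_diagram (map d [m..<Suc t]) i j"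
    using assms(2) by simp
  have "inj_on d {..t}"
    using Suc.prems by (rule inj_on_subset) auto
  note Suc.IH[OF this]
  then show ?case
    by (simp del: upt_Suc add: *[symmetric] algebra_simps)
qed

theorem lemma2p4:
  fixes n t :: nat
    and M :: "(('k::field) mpoly, 'm) gmodule"
    and N :: "('k mpoly, 'l) gmodule"
    and d :: "nat \<Rightarrow> int"
    and \<alpha> :: "nat \<Rightarrow> int"
    and i :: nat and j :: int
  assumes "graded_module n M" and "finitely_generated n M"
    and "strict_mono_on {..t} d"
    and "has_pure_resolution n M (map d [0..<Suc t])"
    and "graded_module n N" and "finitely_generated n N"
    and "betti n N = truncation (betti n M)"
    and "boij_soederberg_decomposition n (betti n N) {1..t} \<alpha> (\<lambda>j. map d [1..<Suc j])"
    and "\<alpha> (Suc t) = 0"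
  shows "of_nat (betti n M i j) =
    (of_nat (betti n M 0 (d 0)) - of_int (\<alpha> 1)) * pure_diagram [d 0] i j +
    (\<Sum>k = 1..t. of_int ((d k - d 0) * \<alpha> k - \<alpha> (Suc k)) * pure_diagram (map d [0..<Suc k]) i j)"
proof -
  have inj: "inj_on d {..t}"
    using assms(3) by (rule strict_mono_on_imp_inj_on)
  show ?thesis
  proof (cases i)
    case 0
    show ?thesis
    proof (cases "j = d 0")
      case True
      \<comment> \<open>Here \<open>j = d 0\<close>, so the coefficients already have telescoping
        form, and \<open>[d 0]\<close> has entry \<open>1\<close> at this place.\<close>
      have "(\<Sum>k = 1..t. of_int ((d k - d 0) * \<alpha> k - \<alpha> (Suc k)) * pure_diagram (map d [0..<Suc k]) i j)
          = of_int (\<alpha> 1)"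
        using sum_pure_diagram_telescope[OF inj, of 0 "d 0" \<alpha> 0] assms(9) 0 True
        by (simp add: pure_diagram_def del: upt_Suc)
      then show ?thesis
        using 0 True by (simp add: pure_diagram_def)
    next
      case False
      then have "betti n M i j = 0"
        using assms(4) 0 unfolding has_pure_resolution_def
        by (metis length_greater_0_conv nth_map nth_upt add_0 length_map length_upt minus_nat.diff_0)
      moreover have "pure_diagram (map d [0..<Suc k]) i j = 0" for k
        using False 0 by (intro pure_diagram_eq_0) (simp del: upt_Suc)
      moreover have "pure_diagram [d 0] i j = 0"
        using False 0 by (intro pure_diagram_eq_0) simp
      ultimately show ?thesis
        by (simp del: upt_Suc)
    qed
  next
    case (Suc i')
    let ?q = "\<lambda>k. pure_diagram (map d [1..<Suc k]) i' j"
    have shift: "pure_diagram (map d [0..<Suc k]) i j = ?q k / of_int (j - d 0)" for k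
      using Suc by (simp add: upt_conv_Cons pure_diagram_Cons del: upt_Suc)
    \<comment> \<open>For \<open>j = d 0\<close> the quotient in \<open>shift\<close> is
      \<open>0\<close> by convention, so the \<open>\<alpha> k\<close> term below must vanish
      too.\<close>
    have q0: "?q k = 0" if "j = d 0" "k \<in> {1..t}" for k
      using that by (intro pure_diagram_eq_0) (auto simp: inj_on_eq_iff[OF inj] simp del: upt_Suc)
    \<comment> \<open>Both ends vanish: the first diagram is that of the empty list, and
      \<open>\<alpha> (Suc t) = 0\<close>.\<close>
    have tele: "(\<Sum>k = 1..t. of_int ((d k - j) * \<alpha> k - \<alpha> (Suc k)) * ?q k) = 0"
      using sum_pure_diagram_telescope[OF inj, of 1 j \<alpha> i'] assms(9)
      by (simp add: pure_diagram_eq_0 del: upt_Suc)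
    \<comment> \<open>Split \<open>d k - d 0\<close> as \<open>(j - d 0) + (d k - j)\<close>: the
      first part cancels the denominator from \<open>shift\<close>, the second sums to zero by
      \<open>tele\<close>.\<close>
    have "of_int ((d k - d 0) * \<alpha> k - \<alpha> (Suc k)) * pure_diagram (map d [0..<Suc k]) i j
        = of_int (\<alpha> k) * ?q k + of_int ((d k - j) * \<alpha> k - \<alpha> (Suc k)) * ?q k / of_int (j - d 0)"
      if "k \<in> {1..t}" for k
    proof (cases "j = d 0")
      case True
      then show ?thesis
        using q0[OF True that] shift by (simp del: upt_Suc)
    next
      case False
      then have "of_int j - of_int (d 0) \<noteq> (0 :: rat)"
        by simp
      then show ?thesis
        unfolding shift by (simp add: field_simps del: upt_Suc)
    qed
    then have "(\<Sum>k = 1..t. of_int ((d k - d 0) * \<alpha> k - \<alpha> (Suc k)) * pure_diagram (map d [0..<Suc k]) i j)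
        = (\<Sum>k = 1..t. of_int (\<alpha> k) * ?q k)"
      using tele by (simp add: sum.distrib flip: sum_divide_distrib del: upt_Suc)
    also have "\<dots> = of_nat (betti n N i' j)"
      using assms(8) unfolding boij_soederberg_decomposition_def by metis
    also have "\<dots> = of_nat (betti n M i j)"
      using Suc by (simp add: assms(7) truncation_def)
    finally show ?thesis
      using Suc by (simp add: pure_diagram_eq_0 del: upt_Suc)
  qed
qed

end
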